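(* Consider the data-center model with three levels of data locality operated under the Balanced-Pandas algorithm (see context). For every arrival rate vector $\boldsymbol\lambda\in\Lambda$, the Markov chain $\{Z(t)=(\bar{\mathbf Q}(t),\mathbf f(t)),t\ge0\}$ is positive recurrent; i.e., Balanced-Pandas is throughput optimal.
   Context: Model. Time is slotted. There are $M$ servers $\mathcal M=\{1,\dots,M\}$ partitioned into racks; $K(m)$ is the rack of server $m$. A task type $\bar L$ is a $3$-element subset of $\mathcal M$; $\mathcal L$ is the set of types. For type $\bar L$, servers in $\bar L$ are local, $\bar L_k=\{m\notin\bar L:\exists n\in\bar L,K(m)=K(n)\}$ rack-local, $\bar L_r=\mathcal M\setminus(\bar L\cup\bar L_k)$ remote. At the start of slot $t$, $A_{\bar L}(t)$ type-$\bar L$ tasks arrive (independent across types, i.i.d. over time, mean $\lambda_{\bar L}$, total per slot bounded). Service times are geometric with means $1/\alpha,1/\beta,1/\gamma$ for local, rack-local, remote service, $1\ge\alpha>\beta>\gamma>0$; one task per server at a time, non-preemptive. Capacity region $\Lambda$: the set of $\boldsymbol\lambda$ for which there exist $\lambda_{\bar L,m}\ge0$ with $\lambda_{\bar L}=\sum_m\lambda_{\bar L,m}$ and $\sum_{\bar L:m\in\bar L}\lambda_{\bar L,m}/\alpha+\sum_{\bar L:m\in\bar L_k}\lambda_{\bar L,m}/\beta+\sum_{\bar L:m\in\bar L_r}\lambda_{\bar L,m}/\gamma<1$ for all $m$. Balanced-Pandas. Each server $m$ has three sub-queues $Q^l_m,Q^k_m,Q^r_m$ holding tasks routed to $m$ that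 are local, rack-local, remote to $m$ respectively. Workload $W_m(t)=Q^l_m(t)/\alpha+Q^k_m(t)/\beta+Q^r_m(t)/\gamma$. Routing: an arriving type-$\bar L$ task is routed to a server in $\arg\min_{m\in\mathcal M}\{\frac{W_m(t)}{\alpha}I_{\{m\in\bar L\}},\frac{W_m(t)}{\beta}I_{\{m\in\bar L_k\}},\frac{W_m(t)}{\gamma}I_{\{m\in\bar L_r\}}\}$ (ties random), joining its local, rack-local or remote sub-queue accordingly. Scheduling: an idle server $m$ serves a task from $Q^l_m$ if nonempty, else from $Q^k_m$ if nonempty, else from $Q^r_m$, else stays idle. Working status $f_m(t)\in\{-1,0,1,2\}$: idle, serving from $Q^l_m$, $Q^k_m$, $Q^r_m$. $\bar{\mathbf Q}(t)$ is the vector of all sub-queue lengths, $\mathbf f(t)=(f_1,\dots,f_M)$. Throughput optimal: the chain is positive recurrent for every $\boldsymbol\lambda\in\Lambda$. *)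

theory Defs
  imports "HOL-Probability.Probability"
begin

primrec traj :: "('s \<Rightarrow> 's pmf) \<Rightarrow> 's \<Rightarrow> nat \<Rightarrow> 's list pmf" where
  "traj P s 0 = return_pmf [s]"
| "traj P s (Suc n) = bind_pmf (traj P s n) (\<lambda>xs. map_pmf (\<lambda>y. xs @ [y]) (P (last xs)))"

text \<open>State s is positive recurrent: the return time T_s = min{n>=1. Z(n)=s} under the
  chain started in s has finite expectation, E[T_s] = sum_{n>=0} P(T_s > n) < infinity.\<close>
definition pos_recurrent_state :: "('s \<Rightarrow> 's pmf) \<Rightarrow> 's \<Rightarrow> bool" where
  "pos_recurrent_state P s \<longleftrightarrow>
     summable (\<lambda>n. measure_pmf.prob (traj P s n) {xs. \<forall>i\<in>{1..n}. xs ! i \<noteq> s})"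

text \<open>The chain is positive recurrent (from initial state z): almost surely it enters the
  set of positive recurrent states, i.e. P(no positive recurrent state among Z(0..n)) -> 0.\<close>
definition chain_pos_recurrent_from :: "('s \<Rightarrow> 's pmf) \<Rightarrow> 's \<Rightarrow> bool" where
  "chain_pos_recurrent_from P z \<longleftrightarrow>
     (\<lambda>n. measure_pmf.prob (traj P z n)
              {xs. \<forall>i\<le>n. \<not> pos_recurrent_state P (xs ! i)}) \<longlonglongrightarrow> 0"

text \<open>Servers are 0..<M; K m is the rack of server m; a task type is a 3-element set of servers.\<close>

definition rack_local :: "nat \<Rightarrow> (nat \<Rightarrow> nat) \<Rightarrow> nat set \<Rightarrow> nat set" where
  "rack_local M K L = {m\<in>{..<M}. m \<notin> L \<and> (\<exists>n\<in>L. K m = K n)}"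

definition remote :: "nat \<Rightarrow> (nat \<Rightarrow> nat) \<Rightarrow> nat set \<Rightarrow> nat set" where
  "remote M K L = {..<M} - (L \<union> rack_local M K L)"

definition is_task_type :: "nat \<Rightarrow> nat set \<Rightarrow> bool" where
  "is_task_type M L \<longleftrightarrow> L \<subseteq> {..<M} \<and> card L = 3"

definition capacity_region ::
  "nat \<Rightarrow> (nat \<Rightarrow> nat) \<Rightarrow> nat set set \<Rightarrow> real \<Rightarrow> real \<Rightarrow> real \<Rightarrow> (nat set \<Rightarrow> real) set" where
  "capacity_region M K Ls \<alpha> \<beta> \<gamma> = {lam. \<exists>lm :: nat set \<Rightarrow> nat \<Rightarrow> real.
      (\<forall>L\<in>Ls. \<forall>m<M. lm L m \<ge> 0) \<and>
      (\<forall>L\<in>Ls. lam L = (\<Sum>m<M. lm L m)) \<and>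
      (\<forall>m<M. (\<Sum>L\<in>{L\<in>Ls. m \<in> L}. lm L m / \<alpha>)
            + (\<Sum>L\<in>{L\<in>Ls. m \<in> rack_local M K L}. lm L m / \<beta>)
            + (\<Sum>L\<in>{L\<in>Ls. m \<in> remote M K L}. lm L m / \<gamma>) < 1)}"

text \<open>State Z = (Q^l, Q^k, Q^r, f). Queue lengths include the task currently in service;
  f m = -1 idle, 0/1/2 serving a task from Q^l/Q^k/Q^r. Indices >= M are unused
  (queues 0, status -1).\<close>
type_synonym bp_state = "(nat \<Rightarrow> nat) \<times> (nat \<Rightarrow> nat) \<times> (nat \<Rightarrow> nat) \<times> (nat \<Rightarrow> int)"

definition valid_state :: "nat \<Rightarrow> bp_state \<Rightarrow> bool" where
  "valid_state M z = (case z of (ql, qk, qr, f) \<Rightarrow>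
     (\<forall>m\<ge>M. ql m = 0 \<and> qk m = 0 \<and> qr m = 0 \<and> f m = -1) \<and>
     (\<forall>m<M. f m \<in> {-1, 0, 1, 2} \<and> (f m = 0 \<longrightarrow> ql m > 0)
            \<and> (f m = 1 \<longrightarrow> qk m > 0) \<and> (f m = 2 \<longrightarrow> qr m > 0)))"

definition workload :: "real \<Rightarrow> real \<Rightarrow> real \<Rightarrow> bp_state \<Rightarrow> nat \<Rightarrow> real" where
  "workload \<alpha> \<beta> \<gamma> z m = (case z of (ql, qk, qr, f) \<Rightarrow>
     real (ql m) / \<alpha> + real (qk m) / \<beta> + real (qr m) / \<gamma>)"

definition route_weight ::
  "nat \<Rightarrow> (nat \<Rightarrow> nat) \<Rightarrow> real \<Rightarrow> real \<Rightarrow> real \<Rightarrow> bp_state \<Rightarrow> nat set \<Rightarrow> nat \<Rightarrow> real" where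
  "route_weight M K \<alpha> \<beta> \<gamma> z L m =
     (if m \<in> L then workload \<alpha> \<beta> \<gamma> z m / \<alpha>
      else if m \<in> rack_local M K L then workload \<alpha> \<beta> \<gamma> z m / \<beta>
      else workload \<alpha> \<beta> \<gamma> z m / \<gamma>)"

definition route_set ::
  "nat \<Rightarrow> (nat \<Rightarrow> nat) \<Rightarrow> real \<Rightarrow> real \<Rightarrow> real \<Rightarrow> bp_state \<Rightarrow> nat set \<Rightarrow> nat set" where
  "route_set M K \<alpha> \<beta> \<gamma> z L =
     {m\<in>{..<M}. \<forall>m'\<in>{..<M}. route_weight M K \<alpha> \<beta> \<gamma> z L m \<le> route_weight M K \<alpha> \<beta> \<gamma> z L m'}"

primrec route_count :: "nat set \<Rightarrow> nat \<Rightarrow> (nat \<Rightarrow> nat) pmf" where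
  "route_count S 0 = return_pmf (\<lambda>_. 0)"
| "route_count S (Suc n) =
     bind_pmf (route_count S n) (\<lambda>c. map_pmf (\<lambda>m. c(m := c m + 1)) (pmf_of_set S))"

definition service_prob :: "real \<Rightarrow> real \<Rightarrow> real \<Rightarrow> int \<Rightarrow> real" where
  "service_prob \<alpha> \<beta> \<gamma> s = (if s = 0 then \<alpha> else if s = 1 then \<beta> else if s = 2 then \<gamma> else 0)"

definition next_status :: "nat \<Rightarrow> nat \<Rightarrow> nat \<Rightarrow> int" where
  "next_status a b c = (if a > 0 then 0 else if b > 0 then 1 else if c > 0 then 2 else -1)"

text \<open>One slot of Balanced-Pandas: arrivals (independent across types, distribution arr L),
  routed with W(t); geometric services (per-slot completion probability alpha/beta/gamma);
  idle servers then pick a task with priority local > rack-local > remote.\<close>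
definition bp_step ::
  "nat \<Rightarrow> (nat \<Rightarrow> nat) \<Rightarrow> nat set set \<Rightarrow> (nat set \<Rightarrow> nat pmf) \<Rightarrow> real \<Rightarrow> real \<Rightarrow> real
   \<Rightarrow> bp_state \<Rightarrow> bp_state pmf" where
  "bp_step M K Ls arr \<alpha> \<beta> \<gamma> z = (case z of (ql, qk, qr, f) \<Rightarrow>
     bind_pmf (Pi_pmf Ls 0 arr) (\<lambda>A.
     bind_pmf (Pi_pmf Ls (\<lambda>_. 0) (\<lambda>L. route_count (route_set M K \<alpha> \<beta> \<gamma> z L) (A L))) (\<lambda>r.
     bind_pmf (Pi_pmf {..<M} False (\<lambda>m. bernoulli_pmf (service_prob \<alpha> \<beta> \<gamma> (f m)))) (\<lambda>done.
     let ql1 = (\<lambda>m. ql m + (\<Sum>L\<in>{L\<in>Ls. m \<in> L}. r L m)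
                     - (if done m \<and> f m = 0 then 1 else 0));
         qk1 = (\<lambda>m. qk m + (\<Sum>L\<in>{L\<in>Ls. m \<in> rack_local M K L}. r L m)
                     - (if done m \<and> f m = 1 then 1 else 0));
         qr1 = (\<lambda>m. qr m + (\<Sum>L\<in>{L\<in>Ls. m \<in> remote M K L}. r L m)
                     - (if done m \<and> f m = 2 then 1 else 0));
         f1 = (\<lambda>m. if m < M then
                     (if f m \<noteq> -1 \<and> \<not> done m then f m else next_status (ql1 m) (qk1 m) (qr1 m))
                   else -1)
     in return_pmf (ql1, qk1, qr1, f1)))))"

end

(*
  The quadratic function sum_m W_m^2 has negative drift. An arriving task of type L changes the
  cross term sum_m W_m a_m by exactly min_m W_m / rate(L,m), which is at most the corresponding
  average under the split lm witnessing membership in the capacity region; a busy server drains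
  one unit of workload per slot in expectation, whatever it serves.

  Irreducibility is not available (with deterministic arrivals the empty state need not even be
  reachable), so recurrence is shown class by class: among the finitely many states of small
  workload, those from which no return is lost ("essential") are reachable from everywhere. Given
  V with negative drift off a finite set F and a target T reachable from F, adding
  A * sum_{k<N} P(T avoided up to time k) repairs the drift on F, since the sum telescopes under
  the chain off T; the resulting function bounds the expected hitting time of T.
*)
theory Submission
  imports Defs
begin

section \<open>Trajectories and the probability of avoiding a set\<close>

definition trans_rel :: "('s \<Rightarrow> 's pmf) \<Rightarrow> ('s \<times> 's) set" where
  "trans_rel P = {(x, y). y \<in> set_pmf (P x)}"

text \<open>The tail P(tau > n) of the hitting time tau of \<open>T\<close>, where time 0 counts as
  a visit. Conditioning on the first step makes it a function of the initial state, which can be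
  averaged under \<open>P x\<close>.\<close>

primrec avoid_prob :: "('s \<Rightarrow> 's pmf) \<Rightarrow> 's set \<Rightarrow> nat \<Rightarrow> 's \<Rightarrow> real" where
  "avoid_prob P T 0 x = (if x \<in> T then 0 else 1)"
| "avoid_prob P T (Suc n) x =
     (if x \<in> T then 0 else measure_pmf.expectation (P x) (avoid_prob P T n))"

lemma length_traj: "xs \<in> set_pmf (traj P x n) \<Longrightarrow> length xs = Suc n"
  by (induction n arbitrary: xs) auto

text \<open>The Markov property at time 1. \<open>traj\<close> grows at its end, while hitting
  probabilities recurse at the front; both extensions commute because the trajectory from
  \<open>y\<close> is nonempty, so prefixing \<open>x\<close> leaves \<open>last\<close>
  unchanged.\<close>

lemma traj_Suc_first:
  "traj P x (Suc n) = bind_pmf (P x) (\<lambda>y. map_pmf ((#) x) (traj P y n))"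
proof (induction n)
  case 0
  show ?case by (simp add: map_pmf_def bind_return_pmf)
next
  case (Suc n)
  have ne: "xs \<noteq> []" if "xs \<in> set_pmf (traj P y n)" for xs y
    using length_traj[OF that] by auto
  have "traj P x (Suc (Suc n)) =
      bind_pmf (P x) (\<lambda>y. bind_pmf (traj P y n)
        (\<lambda>xs. map_pmf (\<lambda>w. (x # xs) @ [w]) (P (last (x # xs)))))"
    unfolding traj.simps(2)[of P x "Suc n"] Suc by (simp add: bind_assoc_pmf bind_map_pmf)
  also have "\<dots> = bind_pmf (P x) (\<lambda>y. map_pmf ((#) x) (traj P y (Suc n)))"
    by (auto simp: map_bind_pmf map_pmf_comp ne intro!: bind_pmf_cong)
  finally show ?case .
qed

lemma avoid_prob_bounds: "0 \<le> avoid_prob P T n x \<and> avoid_prob P T n x \<le> 1"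
proof (induction n arbitrary: x)
  case (Suc n)
  have "0 \<le> measure_pmf.expectation (P x) (avoid_prob P T n)"
    using Suc by (intro Bochner_Integration.integral_nonneg) auto
  moreover have "measure_pmf.expectation (P x) (avoid_prob P T n) \<le> 1"
    using Suc by (intro measure_pmf.integral_le_const measure_pmf.integrable_const_bound[where B=1]) auto
  ultimately show ?case by simp
qed auto

lemma integrable_avoid_prob: "integrable (measure_pmf p) (avoid_prob P T n)"
  using avoid_prob_bounds[of P T n]
  by (intro measure_pmf.integrable_const_bound[where B=1]) auto

lemma prob_bind_pmf:
  "measure_pmf.prob (bind_pmf p f) A = measure_pmf.expectation p (\<lambda>x. measure_pmf.prob (f x) A)"
proof -
  have "ennreal (measure_pmf.prob (bind_pmf p f) A) =
      (\<integral>\<^sup>+ x. ennreal (measure_pmf.prob (f x) A) \<partial>measure_pmf p)"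
    by (simp flip: measure_pmf.emeasure_eq_measure)
  also have "\<dots> = ennreal (measure_pmf.expectation p (\<lambda>x. measure_pmf.prob (f x) A))"
    by (intro nn_integral_eq_integral measure_pmf.integrable_const_bound[where B=1]) auto
  finally show ?thesis
    by (simp add: Bochner_Integration.integral_nonneg)
qed

lemma prob_traj_avoid:
  "measure_pmf.prob (traj P x n) {xs. \<forall>i\<le>n. xs ! i \<notin> T} = avoid_prob P T n x"
proof (induction n arbitrary: x)
  case 0
  show ?case by (simp add: indicator_def)
next
  case (Suc n)
  have "(#) x -` {xs. \<forall>i\<le>Suc n. xs ! i \<notin> T} =
      (if x \<in> T then {} else {xs. \<forall>i\<le>n. xs ! i \<notin> T})"
    by (auto simp: All_less_Suc2 simp flip: less_Suc_eq_le)
  then show ?case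
    unfolding traj_Suc_first by (simp add: prob_bind_pmf Suc)
qed

text \<open>A return ignores time 0, so the tail of the return time is the tail of the hitting time
  of \<open>{s}\<close>, started after one step.\<close>

lemma prob_traj_no_return:
  "measure_pmf.prob (traj P x (Suc n)) {xs. \<forall>i\<in>{1..Suc n}. xs ! i \<noteq> s} =
   measure_pmf.expectation (P x) (avoid_prob P {s} n)"
proof -
  have "(#) x -` {xs. \<forall>i\<in>{1..Suc n}. xs ! i \<noteq> s} = {xs. \<forall>i\<le>n. xs ! i \<notin> {s}}"
    unfolding image_Suc_atMost[symmetric] by (auto simp del: image_Suc_atMost)
  then show ?thesis
    unfolding traj_Suc_first by (simp add: prob_bind_pmf prob_traj_avoid[of _ _ _ "{s}", simplified])
qed

lemma avoid_prob_Suc_le: "avoid_prob P T (Suc n) x \<le> avoid_prob P T n x"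
proof (induction n arbitrary: x)
  case 0
  then show ?case using avoid_prob_bounds[of P T "Suc 0" x] by auto
next
  case (Suc n)
  then show ?case
    by (auto simp del: avoid_prob.simps simp: avoid_prob.simps(2) intro!: integral_mono integrable_avoid_prob)
qed

lemma avoid_prob_antimono: "m \<le> n \<Longrightarrow> avoid_prob P T n x \<le> avoid_prob P T m x"
  using lift_Suc_antimono_le[of "\<lambda>n. avoid_prob P T n x"] avoid_prob_Suc_le by metis

text \<open>Induction backwards along a path into \<open>T\<close>: a successor that may hit
  \<open>T\<close> within \<open>n\<close> steps has positive mass, hence pulls the average at its
  predecessor below 1.\<close>

lemma avoid_prob_less_1:
  assumes "(x, t) \<in> (trans_rel P)\<^sup>*" "t \<in> T"
  shows "\<exists>n. avoid_prob P T n x < 1"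
  using assms(1)
proof (induction rule: converse_rtrancl_induct)
  case base
  then show ?case using assms(2) by (intro exI[of _ 0]) auto
next
  case (step x y)
  then obtain n where n: "avoid_prob P T n y < 1" by auto
  have y: "y \<in> set_pmf (P x)" using step by (auto simp: trans_rel_def)
  have "measure_pmf.expectation (P x) (avoid_prob P T n) < 1"
  \<comment> \<open>If the average of a function bounded by 1 were 1, the function would equal 1 on
    the whole support, in particular at \<open>y\<close>.\<close>
  proof (rule ccontr)
    assume "\<not> ?thesis"
    then have "measure_pmf.expectation (P x) (\<lambda>y. 1 - avoid_prob P T n y) \<le> 0"
      by (simp add: integrable_avoid_prob)
    moreover have "measure_pmf.expectation (P x) (\<lambda>y. 1 - avoid_prob P T n y) \<ge> 0"
      using avoid_prob_bounds[of P T n] by (intro Bochner_Integration.integral_nonneg) auto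
    ultimately have "measure_pmf.expectation (P x) (\<lambda>y. 1 - avoid_prob P T n y) = 0" by simp
    then have "AE y in P x. 1 - avoid_prob P T n y = 0"
      using avoid_prob_bounds[of P T n]
      by (subst (asm) integral_nonneg_eq_0_iff_AE)
         (auto intro!: Bochner_Integration.integrable_diff integrable_avoid_prob)
    then show False using y n by (auto simp: AE_measure_pmf_iff)
  qed
  then show ?case by (intro exI[of _ "Suc n"]) auto
qed

section \<open>A Foster criterion without irreducibility\<close>

locale foster_drift =
  fixes P :: "'s \<Rightarrow> 's pmf" and X F :: "'s set" and V :: "'s \<Rightarrow> real"
  assumes closed: "x \<in> X \<Longrightarrow> set_pmf (P x) \<subseteq> X"
    and finite_support: "x \<in> X \<Longrightarrow> finite (set_pmf (P x))"
    and V_nonneg: "x \<in> X \<Longrightarrow> 0 \<le> V x"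
    and finite_F: "finite F"
    and drift: "x \<in> X \<Longrightarrow> x \<notin> F \<Longrightarrow> measure_pmf.expectation (P x) V \<le> V x - 1"
begin

lemma reach_closed: "(x, y) \<in> (trans_rel P)\<^sup>* \<Longrightarrow> x \<in> X \<Longrightarrow> y \<in> X"
  by (induction rule: rtrancl_induct) (use closed in \<open>auto simp: trans_rel_def\<close>)

lemma integrable_X: "x \<in> X \<Longrightarrow> integrable (measure_pmf (P x)) (h :: 's \<Rightarrow> real)"
  by (intro integrable_measure_pmf_finite finite_support)

text \<open>The series is the expected hitting time of \<open>T\<close> from \<open>x\<close>. It is
  bounded by a function \<open>W\<close> whose drift is at most -1 at every reachable state off
  \<open>T\<close>, including those in \<open>F\<close>.\<close>

lemma summable_avoid_prob:
  assumes x: "x \<in> X"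
    and reach: "\<And>y. (x, y) \<in> (trans_rel P)\<^sup>* \<Longrightarrow> y \<in> F \<Longrightarrow> \<exists>t\<in>T. (y, t) \<in> (trans_rel P)\<^sup>*"
  shows "summable (\<lambda>n. avoid_prob P T n x)"
proof -
  \<comment> \<open>The target is known to be reachable only from those states of \<open>F\<close>
    that \<open>x\<close> can reach, so the argument stays inside this closed set.\<close>
  define Y where "Y = (trans_rel P)\<^sup>* `` {x}"
  have YX: "Y \<subseteq> X" using reach_closed x by (auto simp: Y_def)
  have Y_closed: "set_pmf (P y) \<subseteq> Y" if "y \<in> Y" for y
    using that by (auto simp: Y_def trans_rel_def intro: rtrancl_into_rtrancl)
  have "\<exists>n. avoid_prob P T n y < 1" if "y \<in> F \<inter> Y" for y
  proof -
    obtain t where "t \<in> T" "(y, t) \<in> (trans_rel P)\<^sup>*"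
      using reach[of y] \<open>y \<in> F \<inter> Y\<close> by (auto simp: Y_def)
    then show ?thesis by (rule avoid_prob_less_1[rotated])
  qed
  then obtain n where n: "\<And>y. y \<in> F \<inter> Y \<Longrightarrow> avoid_prob P T (n y) y < 1" by metis
  \<comment> \<open>Finiteness of \<open>F\<close> gives one horizon for all its reachable states; a
    longer horizon only lowers the avoidance probability.\<close>
  define N where "N = Max (n ` (F \<inter> Y))"
  have N: "avoid_prob P T N y < 1" if "y \<in> F \<inter> Y" for y
  proof -
    have "n y \<le> N" unfolding N_def using that finite_F by (intro Max_ge) auto
    then show ?thesis using avoid_prob_antimono[of "n y" N P T y] n[OF that] by linarith
  qed
  \<comment> \<open>The factor by which \<open>1 - avoid_prob P T N y\<close> must be scaled to
    cover the drift defect of \<open>V\<close> at \<open>y\<close>. These factors are nonnegative on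
    \<open>F \<inter> Y\<close>, so their sum \<open>A\<close> covers every such state at
    once.\<close>
  define g where "g y = \<bar>measure_pmf.expectation (P y) V - V y + 1\<bar> / (1 - avoid_prob P T N y)" for y
  define A where "A = (\<Sum>y\<in>F \<inter> Y. g y)"
  have g_nonneg: "0 \<le> g y" if "y \<in> F \<inter> Y" for y
    using N[OF that] by (simp add: g_def)
  have A_nonneg: "0 \<le> A" unfolding A_def by (intro sum_nonneg g_nonneg)
  have V_drift: "measure_pmf.expectation (P y) V \<le> V y - 1 + A * (1 - avoid_prob P T N y)"
    if y: "y \<in> Y" for y
  proof (cases "y \<in> F")
    case True
    then have yF: "y \<in> F \<inter> Y" using y by simp
    have "g y \<le> A" unfolding A_def
      using yF g_nonneg finite_F by (intro member_le_sum) auto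
    then have "g y * (1 - avoid_prob P T N y) \<le> A * (1 - avoid_prob P T N y)"
      using N[OF yF] by (intro mult_right_mono) auto
    then show ?thesis using N[OF yF] by (simp add: g_def)
  next
    case False
    then show ?thesis
      using drift[of y] y YX A_nonneg avoid_prob_bounds[of P T N y]
      by (smt (verit) mult_nonneg_nonneg subsetD)
  qed
  define W where "W y = V y + A * (\<Sum>k<N. avoid_prob P T k y)" for y
  have W_nonneg: "0 \<le> W y" if "y \<in> Y" for y
    using V_nonneg YX that A_nonneg avoid_prob_bounds[of P T _ y]
    by (auto simp: W_def intro!: add_nonneg_nonneg mult_nonneg_nonneg sum_nonneg)
  have W_drift: "1 + measure_pmf.expectation (P y) W \<le> W y" if y: "y \<in> Y" and yT: "y \<notin> T" for y
  proof -
    have yX: "y \<in> X" using y YX by auto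
    have "measure_pmf.expectation (P y) W =
        measure_pmf.expectation (P y) V + A * (\<Sum>k<N. avoid_prob P T (Suc k) y)"
      using yT by (simp add: W_def[abs_def] integrable_X[OF yX] integrable_avoid_prob)
    \<comment> \<open>Only the end terms survive. As \<open>avoid_prob P T 0 y\<close> is 1 off
      \<open>T\<close>, the correction drops by \<open>1 - avoid_prob P T N y\<close>, the very term
      that \<open>V_drift\<close> leaves over.\<close>
    also have "(\<Sum>k<N. avoid_prob P T (Suc k) y) =
        (\<Sum>k<N. avoid_prob P T k y) + avoid_prob P T N y - avoid_prob P T 0 y"
      using sum_lessThan_telescope[of "\<lambda>k. avoid_prob P T k y" N]
      by (simp del: avoid_prob.simps add: sum_subtractf)
    finally show ?thesis
      using V_drift[OF y] yT by (simp add: W_def[abs_def] algebra_simps)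
  qed
  \<comment> \<open>A nonnegative \<open>W\<close> with \<open>1 + E W \<le> W\<close> off
    \<open>T\<close> dominates every truncated expected hitting time; the induction on the
    truncation replaces a stopping-time argument.\<close>
  have bound: "(\<Sum>k<n. avoid_prob P T k y) \<le> W y" if "y \<in> Y" for n y
    using that
  proof (induction n arbitrary: y)
    case 0
    then show ?case using W_nonneg by simp
  next
    case (Suc n)
    show ?case
    proof (cases "y \<in> T")
      case True
      then have "avoid_prob P T k y = 0" for k by (cases k) auto
      then show ?thesis using W_nonneg Suc by simp
    next
      case False
      have yX: "y \<in> X" using Suc YX by auto
      have "(\<Sum>k<Suc n. avoid_prob P T k y) =
          1 + measure_pmf.expectation (P y) (\<lambda>z. \<Sum>k<n. avoid_prob P T k z)"
        unfolding sum.lessThan_Suc_shift using False by (simp add: integrable_avoid_prob)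
      also have "\<dots> \<le> 1 + measure_pmf.expectation (P y) W"
        using Suc.IH Y_closed[OF Suc.prems]
        by (intro add_left_mono integral_mono_AE integrable_X[OF yX]) (auto simp: AE_measure_pmf_iff)
      also have "\<dots> \<le> W y" using W_drift Suc False by simp
      finally show ?thesis .
    qed
  qed
  have "x \<in> Y" by (simp add: Y_def)
  then show ?thesis
    using avoid_prob_bounds[of P T _ x] bound
    by (intro summableI_nonneg_bounded[where x="W x"]) auto
qed

text \<open>Membership in a closed communicating class, tested only against states of
  \<open>F\<close>; the restriction to a finite set guarantees that such states exist below every
  state of \<open>F \<inter> X\<close>.\<close>

definition essential :: "'s set" where
  "essential = {s \<in> F \<inter> X. \<forall>y\<in>F. (s, y) \<in> (trans_rel P)\<^sup>* \<longrightarrow> (y, s) \<in> (trans_rel P)\<^sup>*}"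

text \<open>Descent on the number of states of \<open>F\<close> within reach: a state that is not
  essential reaches some \<open>y\<close> in \<open>F\<close> that cannot come back, and the reach
  of \<open>y\<close> is smaller at least by \<open>x\<close> itself.\<close>

lemma essential_reachable:
  "x \<in> F \<Longrightarrow> x \<in> X \<Longrightarrow> \<exists>t\<in>essential. (x, t) \<in> (trans_rel P)\<^sup>*"
proof (induction "card {y \<in> F. (x, y) \<in> (trans_rel P)\<^sup>*}" arbitrary: x rule: less_induct)
  case less
  show ?case
  proof (cases "x \<in> essential")
    case False
    then obtain y where y: "y \<in> F" "(x, y) \<in> (trans_rel P)\<^sup>*" "(y, x) \<notin> (trans_rel P)\<^sup>*"
      using less.prems by (auto simp: essential_def)
    have "{z \<in> F. (y, z) \<in> (trans_rel P)\<^sup>*} \<subset> {z \<in> F. (x, z) \<in> (trans_rel P)\<^sup>*}"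
      using y less.prems by (auto intro: rtrancl_trans)
    then have "card {z \<in> F. (y, z) \<in> (trans_rel P)\<^sup>*} < card {z \<in> F. (x, z) \<in> (trans_rel P)\<^sup>*}"
      using finite_F by (intro psubset_card_mono) auto
    then obtain t where "t \<in> essential" "(y, t) \<in> (trans_rel P)\<^sup>*"
      using less.hyps y reach_closed less.prems by blast
    then show ?thesis using y by (auto intro: rtrancl_trans)
  qed auto
qed

text \<open>Any state of \<open>F\<close> reached from a successor of \<open>s\<close> is reached
  from \<open>s\<close>, hence leads back to \<open>s\<close>. The hitting time of
  \<open>{s}\<close> thus has finite mean from each successor, and there are finitely many of
  these.\<close>

lemma essential_pos_recurrent:
  assumes "s \<in> essential"
  shows "pos_recurrent_state P s"
proof -
  have s: "s \<in> X" using assms by (auto simp: essential_def)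
  have "summable (\<lambda>n. avoid_prob P {s} n y)" if y: "y \<in> set_pmf (P s)" for y
  proof (rule summable_avoid_prob)
    show "y \<in> X" using y closed s by auto
    fix z assume "(y, z) \<in> (trans_rel P)\<^sup>*" "z \<in> F"
    then show "\<exists>t\<in>{s}. (z, t) \<in> (trans_rel P)\<^sup>*"
      using assms y
      by (auto simp: essential_def trans_rel_def intro: converse_rtrancl_into_rtrancl)
  qed
  then have "summable (\<lambda>n. \<Sum>y\<in>set_pmf (P s). pmf (P s) y * avoid_prob P {s} n y)"
    by (intro summable_sum summable_mult)
  moreover have "(\<Sum>y\<in>set_pmf (P s). pmf (P s) y * avoid_prob P {s} n y) =
      measure_pmf.expectation (P s) (avoid_prob P {s} n)" for n
    using finite_support[OF s] by (subst integral_measure_pmf) auto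
  ultimately show ?thesis
    unfolding pos_recurrent_state_def
    \<comment> \<open>Dropping the term at time 0 leaves the indices of the form
      \<open>Suc n\<close> that \<open>prob_traj_no_return\<close> covers.\<close>
    by (subst summable_Suc_iff[symmetric]) (simp only: prob_traj_no_return)
qed

text \<open>The avoidance probabilities of \<open>essential\<close> are summable and so vanish; the
  positive recurrent states include \<open>essential\<close> and are avoided with at most that
  probability.\<close>

lemma chain_pos_recurrent:
  assumes "x \<in> X"
  shows "chain_pos_recurrent_from P x"
proof -
  have "summable (\<lambda>n. avoid_prob P essential n x)"
    using assms essential_reachable reach_closed by (intro summable_avoid_prob) blast+
  then have "(\<lambda>n. measure_pmf.prob (traj P x n) {xs. \<forall>i\<le>n. xs ! i \<notin> essential}) \<longlonglongrightarrow> 0"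
    by (simp add: prob_traj_avoid summable_LIMSEQ_zero)
  then show ?thesis
    unfolding chain_pos_recurrent_from_def
    by (rule tendsto_sandwich[OF always_eventually always_eventually tendsto_const, rotated 2])
       (auto intro!: measure_pmf.finite_measure_mono dest: essential_pos_recurrent)
qed

end

text \<open>Needed because an arbitrary valid initial state may lie outside the set on which the
  drift is controlled, while all its successors lie inside. A finite average of null sequences is
  null.\<close>

lemma chain_pos_recurrent_from_step:
  assumes fin: "finite (set_pmf (P x))"
    and step: "\<And>y. y \<in> set_pmf (P x) \<Longrightarrow> chain_pos_recurrent_from P y"
  shows "chain_pos_recurrent_from P x"
proof -
  define T where "T = {s. pos_recurrent_state P s}"
  have eq: "chain_pos_recurrent_from P y \<longleftrightarrow> (\<lambda>n. avoid_prob P T n y) \<longlonglongrightarrow> 0" for y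
    by (simp add: chain_pos_recurrent_from_def prob_traj_avoid[symmetric] T_def)
  have "(\<lambda>n. avoid_prob P T (Suc n) x) \<longlonglongrightarrow> 0"
  proof (cases "x \<in> T")
    case False
    have "(\<lambda>n. \<Sum>y\<in>set_pmf (P x). pmf (P x) y * avoid_prob P T n y) \<longlonglongrightarrow>
        (\<Sum>y\<in>set_pmf (P x). pmf (P x) y * 0)"
      using step eq by (intro tendsto_intros) auto
    moreover have "(\<Sum>y\<in>set_pmf (P x). pmf (P x) y * avoid_prob P T n y) =
        avoid_prob P T (Suc n) x" for n
      using fin False by (simp add: integral_measure_pmf[where A="set_pmf (P x)"])
    ultimately show ?thesis by (simp del: avoid_prob.simps)
  qed simp
  then show ?thesis
    unfolding eq by (rule LIMSEQ_imp_Suc)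
qed

section \<open>Expectations under finite support, and routing counts\<close>

lemma expectation_bind_le:
  fixes h :: "'b \<Rightarrow> real"
  assumes fin: "finite (set_pmf p)" "\<And>x. x \<in> set_pmf p \<Longrightarrow> finite (set_pmf (f x))"
    and le: "\<And>x. x \<in> set_pmf p \<Longrightarrow> measure_pmf.expectation (f x) h \<le> g x"
  shows "measure_pmf.expectation (bind_pmf p f) h \<le> measure_pmf.expectation p g"
proof -
  have "measure_pmf.expectation (bind_pmf p f) h =
      (\<Sum>x\<in>set_pmf p. pmf p x * measure_pmf.expectation (f x) h)"
    using fin by (subst pmf_expectation_bind[where A="set_pmf p"]) auto
  also have "\<dots> \<le> (\<Sum>x\<in>set_pmf p. pmf p x * g x)"
    using le by (intro sum_mono mult_left_mono) auto
  also have "\<dots> = measure_pmf.expectation p g"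
    using fin by (subst integral_measure_pmf[where A="set_pmf p"]) auto
  finally show ?thesis .
qed

lemma finite_set_Pi_pmf:
  assumes "finite A" "\<And>x. x \<in> A \<Longrightarrow> finite (set_pmf (p x))"
  shows "finite (set_pmf (Pi_pmf A d p))"
  using assms by (auto simp: set_Pi_pmf intro!: finite_PiE_dflt)

lemma expectation_Pi_pmf_component:
  fixes g :: "'b \<Rightarrow> real"
  assumes "finite A" "x \<in> A"
  shows "measure_pmf.expectation (Pi_pmf A d p) (\<lambda>f. g (f x)) = measure_pmf.expectation (p x) g"
proof -
  have "measure_pmf.expectation (Pi_pmf A d p) (\<lambda>f. g (f x)) =
      measure_pmf.expectation (map_pmf (\<lambda>f. f x) (Pi_pmf A d p)) g" by simp
  then show ?thesis using assms by (simp only: Pi_pmf_component if_True)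
qed

lemma route_count_support:
  assumes "finite S" "S \<noteq> {}" "c \<in> set_pmf (route_count S n)"
  shows "(\<forall>m. m \<notin> S \<longrightarrow> c m = 0) \<and> sum c S = n"
  using assms(3)
proof (induction n arbitrary: c)
  case (Suc n)
  then obtain c' m where c': "c' \<in> set_pmf (route_count S n)" "m \<in> S" "c = c'(m := c' m + 1)"
    using assms by auto
  have "sum c S = sum c' S + 1"
    using c'(2) assms(1) by (simp add: c'(3) sum.remove[where x=m])
  then show ?case using Suc.IH[OF c'(1)] c' by auto
qed auto

lemma finite_set_route_count:
  "finite S \<Longrightarrow> S \<noteq> {} \<Longrightarrow> finite (set_pmf (route_count S n))"
  by (induction n) auto

lemma next_status_valid:
  "next_status a b c \<in> {-1, 0, 1, 2}"
  "next_status a b c = 0 \<Longrightarrow> a > 0"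
  "next_status a b c = 1 \<Longrightarrow> b > 0"
  "next_status a b c = 2 \<Longrightarrow> c > 0"
  "next_status a b c = -1 \<Longrightarrow> a = 0 \<and> b = 0 \<and> c = 0"
  by (auto simp: next_status_def split: if_splits)

section \<open>Service rates, routing and the state update\<close>

locale balanced_pandas =
  fixes M :: nat and K :: "nat \<Rightarrow> nat" and Ls :: "nat set set"
    and arr :: "nat set \<Rightarrow> nat pmf" and \<alpha> \<beta> \<gamma> :: real and B :: nat
  assumes types: "\<forall>L\<in>Ls. is_task_type M L"
    and params: "1 \<ge> \<alpha>" "\<alpha> > \<beta>" "\<beta> > \<gamma>" "\<gamma> > 0"
    and bounded: "\<forall>L\<in>Ls. set_pmf (arr L) \<subseteq> {..B}"
begin

abbreviation "W \<equiv> workload \<alpha> \<beta> \<gamma>"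

text \<open>Merging the three localities turns routing weights into \<open>W z m / rate L m\<close>
  and each capacity constraint into a single sum.\<close>

definition rate :: "nat set \<Rightarrow> nat \<Rightarrow> real" where
  "rate L m = (if m \<in> L then \<alpha> else if m \<in> rack_local M K L then \<beta> else \<gamma>)"

lemma rate_bounds: "\<gamma> \<le> rate L m" "0 < rate L m"
  using params by (auto simp: rate_def)

lemma route_weight_eq: "route_weight M K \<alpha> \<beta> \<gamma> z L m = W z m / rate L m"
  by (simp add: route_weight_def rate_def)

lemma W_nonneg: "0 \<le> W z m"
  using params by (auto simp: workload_def split: prod.splits)

lemma finite_Ls: "finite Ls"
  using types by (intro finite_subset[of Ls "Pow {..<M}"]) (auto simp: is_task_type_def)

lemma M_pos: "L \<in> Ls \<Longrightarrow> 0 < M"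
  using types by (cases M) (auto simp: is_task_type_def)

text \<open>For \<open>m < M\<close> each type is exactly one of local, rack-local and remote to
  \<open>m\<close>. This serves both the capacity constraints and the workload increments.\<close>

lemma sum_by_locality:
  fixes g :: "nat set \<Rightarrow> real"
  assumes "m < M"
  shows "(\<Sum>L\<in>{L\<in>Ls. m \<in> L}. g L / \<alpha>) + (\<Sum>L\<in>{L\<in>Ls. m \<in> rack_local M K L}. g L / \<beta>)
      + (\<Sum>L\<in>{L\<in>Ls. m \<in> remote M K L}. g L / \<gamma>) = (\<Sum>L\<in>Ls. g L / rate L m)"
proof -
  have "m \<notin> rack_local M K L" if "m \<in> L" for L using that by (simp add: rack_local_def)
  then show ?thesis
    using assms finite_Ls
    by (auto simp: sum.inter_filter rate_def remote_def simp flip: sum.distrib intro!: sum.cong)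
qed

definition min_weight :: "bp_state \<Rightarrow> nat set \<Rightarrow> real" where
  "min_weight z L = Min ((\<lambda>m. W z m / rate L m) ` {..<M})"

lemma min_weight_le: "m < M \<Longrightarrow> min_weight z L \<le> W z m / rate L m"
  by (auto simp: min_weight_def)

lemma route_set_eq:
  "route_set M K \<alpha> \<beta> \<gamma> z L = {m. m < M \<and> W z m / rate L m = min_weight z L}"
proof (cases "M = 0")
  case False
  then have "min_weight z L \<in> (\<lambda>m. W z m / rate L m) ` {..<M}"
    unfolding min_weight_def by (intro Min_in) auto
  then obtain k where k: "k < M" "min_weight z L = W z k / rate L k" by auto
  show ?thesis
    using min_weight_le[of _ z L] k
    by (auto simp: route_set_def route_weight_eq intro!: antisym) 
qed (simp add: route_set_def)

lemma route_set_nonempty: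
  assumes "L \<in> Ls"
  shows "route_set M K \<alpha> \<beta> \<gamma> z L \<noteq> {}"
proof -
  have "min_weight z L \<in> (\<lambda>m. W z m / rate L m) ` {..<M}"
    unfolding min_weight_def using M_pos[OF assms] by (intro Min_in) auto
  then show ?thesis by (auto simp: route_set_eq)
qed

lemma finite_route_set: "finite (route_set M K \<alpha> \<beta> \<gamma> z L)"
  by (simp add: route_set_def)

text \<open>The deterministic part of a slot, given routing counts \<open>r\<close> and completions
  \<open>d\<close>. Splitting it from the sampling allows bounds for each outcome
  separately.\<close>

definition bp_next :: "bp_state \<Rightarrow> (nat set \<Rightarrow> nat \<Rightarrow> nat) \<Rightarrow> (nat \<Rightarrow> bool) \<Rightarrow> bp_state" where
  "bp_next z r d = (case z of (ql, qk, qr, f) \<Rightarrow>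
     let ql1 = (\<lambda>m. ql m + (\<Sum>L\<in>{L\<in>Ls. m \<in> L}. r L m)
                     - (if d m \<and> f m = 0 then 1 else 0));
         qk1 = (\<lambda>m. qk m + (\<Sum>L\<in>{L\<in>Ls. m \<in> rack_local M K L}. r L m)
                     - (if d m \<and> f m = 1 then 1 else 0));
         qr1 = (\<lambda>m. qr m + (\<Sum>L\<in>{L\<in>Ls. m \<in> remote M K L}. r L m)
                     - (if d m \<and> f m = 2 then 1 else 0));
         f1 = (\<lambda>m. if m < M then
                     (if f m \<noteq> -1 \<and> \<not> d m then f m else next_status (ql1 m) (qk1 m) (qr1 m))
                   else -1)
     in (ql1, qk1, qr1, f1))"

definition status :: "bp_state \<Rightarrow> nat \<Rightarrow> int" where
  "status z = snd (snd (snd z))"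

abbreviation "arrivals \<equiv> Pi_pmf Ls 0 arr"
abbreviation "routing z A \<equiv>
  Pi_pmf Ls (\<lambda>_. 0) (\<lambda>L. route_count (route_set M K \<alpha> \<beta> \<gamma> z L) (A L))"
abbreviation "services z \<equiv>
  Pi_pmf {..<M} False (\<lambda>m. bernoulli_pmf (service_prob \<alpha> \<beta> \<gamma> (status z m)))"

lemma bp_step_eq:
  "bp_step M K Ls arr \<alpha> \<beta> \<gamma> z =
     bind_pmf arrivals (\<lambda>A. bind_pmf (routing z A) (\<lambda>r. map_pmf (bp_next z r) (services z)))"
  by (cases z) (simp add: bp_step_def bp_next_def status_def map_pmf_def Let_def)

lemma arrivals_support: "A \<in> set_pmf arrivals \<Longrightarrow> L \<in> Ls \<Longrightarrow> A L \<le> B"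
  using bounded finite_Ls by (fastforce simp: set_Pi_pmf PiE_dflt_def)

lemma routing_support:
  assumes "r \<in> set_pmf (routing z A)" "L \<in> Ls"
  shows "r L m > 0 \<Longrightarrow> m < M \<and> W z m / rate L m = min_weight z L" "(\<Sum>m<M. r L m) = A L"
proof -
  let ?S = "route_set M K \<alpha> \<beta> \<gamma> z L"
  have "r L \<in> set_pmf (route_count ?S (A L))"
    using assms finite_Ls by (auto simp: set_Pi_pmf PiE_dflt_def)
  note * = route_count_support[OF finite_route_set route_set_nonempty[OF assms(2)] this]
  show "r L m > 0 \<Longrightarrow> m < M \<and> W z m / rate L m = min_weight z L"
    using * by (cases "m \<in> ?S") (auto simp: route_set_eq)
  have "(\<Sum>m<M. r L m) = sum (r L) ?S"
    using * by (intro sum.mono_neutral_right) (auto simp: route_set_def)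
  then show "(\<Sum>m<M. r L m) = A L" using * by simp
qed

lemma finite_arrivals: "finite (set_pmf arrivals)"
  using bounded finite_Ls by (intro finite_set_Pi_pmf) (auto intro: finite_subset)

lemma finite_routing: "finite (set_pmf (routing z A))"
  using finite_Ls by (intro finite_set_Pi_pmf finite_set_route_count finite_route_set route_set_nonempty)

lemma finite_services: "finite (set_pmf (services z))"
  by (intro finite_set_Pi_pmf) auto

lemma finite_bp_step: "finite (set_pmf (bp_step M K Ls arr \<alpha> \<beta> \<gamma> z))"
  using finite_arrivals finite_routing finite_services by (simp add: bp_step_eq)

text \<open>\<open>valid_state\<close> permits an idle server with waiting tasks, whose workload
  would not be drained in that slot; such states are excluded here.\<close>

definition good_states :: "bp_state set" where
  "good_states = {z. valid_state M z \<and> (\<forall>m<M. status z m = -1 \<longrightarrow> W z m = 0)}"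

text \<open>A server ends a slot idle only through \<open>next_status\<close>, which yields -1 only
  on three empty queues. One step from any valid state therefore suffices.\<close>

lemma bp_next_good:
  assumes z: "valid_state M z" and r: "r \<in> set_pmf (routing z A)"
  shows "bp_next z r d \<in> good_states"
proof -
  obtain ql qk qr f where zz: "z = (ql, qk, qr, f)" by (cases z)
  obtain ql1 qk1 qr1 f1 where step: "bp_next z r d = (ql1, qk1, qr1, f1)"
    by (cases "bp_next z r d")
  have ql1: "ql1 m = ql m + (\<Sum>L\<in>{L\<in>Ls. m \<in> L}. r L m) - (if d m \<and> f m = 0 then 1 else 0)"
    and qk1: "qk1 m = qk m + (\<Sum>L\<in>{L\<in>Ls. m \<in> rack_local M K L}. r L m)
      - (if d m \<and> f m = 1 then 1 else 0)"
    and qr1: "qr1 m = qr m + (\<Sum>L\<in>{L\<in>Ls. m \<in> remote M K L}. r L m)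
      - (if d m \<and> f m = 2 then 1 else 0)"
    and f1: "f1 m = (if m < M then
      if f m \<noteq> -1 \<and> \<not> d m then f m else next_status (ql1 m) (qk1 m) (qr1 m) else -1)" for m
    using step by (auto simp: zz bp_next_def Let_def simp del: One_nat_def)
  have zero: "r L m = 0" if "M \<le> m" "L \<in> Ls" for L m
    using routing_support(1)[OF r that(2), of m] that(1) by (cases "r L m = 0") auto
  have outside: "ql1 m = 0 \<and> qk1 m = 0 \<and> qr1 m = 0 \<and> f1 m = -1" if m: "M \<le> m" for m
  proof -
    have "ql m = 0" "qk m = 0" "qr m = 0"
      using z m by (auto simp: zz valid_state_def)
    then show ?thesis using m by (simp add: ql1 qk1 qr1 f1 zero)
  qed
  have inside: "f1 m \<in> {-1, 0, 1, 2} \<and> (f1 m = 0 \<longrightarrow> ql1 m > 0) \<and> (f1 m = 1 \<longrightarrow> qk1 m > 0)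
      \<and> (f1 m = 2 \<longrightarrow> qr1 m > 0) \<and> (f1 m = -1 \<longrightarrow> ql1 m = 0 \<and> qk1 m = 0 \<and> qr1 m = 0)"
    if m: "m < M" for m
  \<comment> \<open>Without a completion no queue of \<open>m\<close> shrinks, so the queue holding
    the task in service stays nonempty; otherwise the status is chosen afresh.\<close>
  proof (cases "f m \<noteq> -1 \<and> \<not> d m")
    case True
    then have "f1 m = f m" "ql m \<le> ql1 m" "qk m \<le> qk1 m" "qr m \<le> qr1 m"
      using m by (simp_all add: f1 ql1 qk1 qr1)
    moreover have "f m \<in> {-1, 0, 1, 2}" "f m = 0 \<longrightarrow> ql m > 0" "f m = 1 \<longrightarrow> qk m > 0"
        "f m = 2 \<longrightarrow> qr m > 0"
      using z m by (auto simp: zz valid_state_def)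
    ultimately show ?thesis using True by auto
  next
    case False
    then have "f1 m = next_status (ql1 m) (qk1 m) (qr1 m)" using m by (auto simp: f1)
    then show ?thesis using next_status_valid[of "ql1 m" "qk1 m" "qr1 m"] by presburger
  qed
  have "valid_state M (bp_next z r d)"
    unfolding step valid_state_def prod.case using outside inside by blast
  moreover have "W (bp_next z r d) m = 0" if "m < M" "status (bp_next z r d) m = -1" for m
    using that inside[of m] by (simp add: step status_def workload_def)
  ultimately show ?thesis by (simp add: good_states_def)
qed

lemma bp_step_good:
  assumes "valid_state M z"
  shows "set_pmf (bp_step M K Ls arr \<alpha> \<beta> \<gamma> z) \<subseteq> good_states"
  using bp_next_good[OF assms] by (auto simp: bp_step_eq)

section \<open>Change of workload in one slot\<close>

definition served :: "bp_state \<Rightarrow> (nat \<Rightarrow> bool) \<Rightarrow> nat \<Rightarrow> real" where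
  "served z d m = (if d m \<and> status z m \<in> {0, 1, 2} 
     then 1 / service_prob \<alpha> \<beta> \<gamma> (status z m) else 0)"

lemma workload_bp_next:
  assumes z: "valid_state M z" and m: "m < M"
  shows "W (bp_next z r d) m = W z m + (\<Sum>L\<in>Ls. real (r L m) / rate L m) - served z d m"
proof -
  obtain ql qk qr f where zz: "z = (ql, qk, qr, f)" by (cases z)
  \<comment> \<open>Subtraction on naturals is exact here: a task leaves only the queue named by the
    status, and validity makes that queue nonempty.\<close>
  have [simp]: "real (a + b - (if Q then 1 else 0)) = real a + real b - (if Q then 1 else 0)"
    if "Q \<Longrightarrow> a > 0" for a b Q
    using that by (cases a) auto
  have v: "f m = 0 \<Longrightarrow> ql m > 0" "f m = 1 \<Longrightarrow> qk m > 0" "f m = 2 \<Longrightarrow> qr m > 0"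
    using z m by (auto simp: zz valid_state_def)
  show ?thesis
    unfolding sum_by_locality[OF m, symmetric]
    using v by (auto simp: zz bp_next_def Let_def workload_def served_def status_def service_prob_def
        add_divide_distrib diff_divide_distrib sum_divide_distrib)
qed

text \<open>A busy server finishes with probability p and then sheds workload 1/p, so it sheds 1 on
  average whatever it serves. An idle server sheds nothing, but in a good state its workload is 0;
  the factor \<open>W z m\<close> unites both cases.\<close>

lemma expectation_served:
  assumes z: "z \<in> good_states" and m: "m < M"
  shows "W z m * measure_pmf.expectation (services z) (\<lambda>d. served z d m) = W z m"
proof (cases "status z m = -1")
  case True
  then show ?thesis using z m by (simp add: good_states_def)
next
  case False
  then have st: "status z m \<in> {0, 1, 2}"
    using z m by (cases z) (auto simp: good_states_def valid_state_def status_def)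
  then have p: "0 < service_prob \<alpha> \<beta> \<gamma> (status z m)" "service_prob \<alpha> \<beta> \<gamma> (status z m) \<le> 1"
    using params by (auto simp: service_prob_def)
  have "measure_pmf.expectation (services z) (\<lambda>d. served z d m) =
      measure_pmf.expectation (bernoulli_pmf (service_prob \<alpha> \<beta> \<gamma> (status z m)))
        (\<lambda>b. if b then 1 / service_prob \<alpha> \<beta> \<gamma> (status z m) else 0)"
    using st m unfolding served_def
    by (subst expectation_Pi_pmf_component[symmetric, where A="{..<M}" and x=m and d=False]) auto
  also have "\<dots> = 1" using p by simp
  finally show ?thesis by simp
qed

section \<open>Drift of the quadratic Lyapunov function\<close>

definition lyap :: "bp_state \<Rightarrow> real" where
  "lyap z = (\<Sum>m<M. (W z m)\<^sup>2)"

text \<open>Bounds the change of one server's workload in a slot: at most \<open>B\<close> tasks of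
  each type arrive and at most one task leaves, each worth at most
  \<open>1 / \<gamma>\<close>.\<close>

definition jump_bound :: real where
  "jump_bound = real (card Ls) * real B / \<gamma> + 1 / \<gamma>"

text \<open>Each routed task contributes exactly the minimal weight to the cross term, whichever
  minimiser it was sent to; this is why no expectation over the routing is needed.\<close>
lemma lyap_bp_next:
  assumes z: "valid_state M z" and A: "A \<in> set_pmf arrivals" and r: "r \<in> set_pmf (routing z A)"
  shows "lyap (bp_next z r d) \<le> lyap z + real M * jump_bound\<^sup>2
    + 2 * (\<Sum>L\<in>Ls. real (A L) * min_weight z L) - 2 * (\<Sum>m<M. W z m * served z d m)"
proof -
  define a where "a m = (\<Sum>L\<in>Ls. real (r L m) / rate L m)" for m
  have a_nonneg: "0 \<le> a m" for m
    using rate_bounds by (auto simp: a_def less_imp_le intro!: sum_nonneg)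
  have a_le: "a m \<le> real (card Ls) * real B / \<gamma>" if m: "m < M" for m
  proof -
    have "real (r L m) / rate L m \<le> real B / \<gamma>" if L: "L \<in> Ls" for L
    proof -
      have "r L m \<le> (\<Sum>m<M. r L m)" using m by (intro member_le_sum) auto
      then have "r L m \<le> B" using routing_support(2)[OF r L] arrivals_support[OF A L] by simp
      then show ?thesis using rate_bounds params by (intro frac_le) auto
    qed
    then show ?thesis unfolding a_def using sum_bounded_above[of Ls _ "real B / \<gamma>"] by force
  qed
  have served: "0 \<le> served z d m \<and> served z d m \<le> 1 / \<gamma>" for m
    using params by (auto simp: served_def service_prob_def frac_le)
  have sq: "(a m - served z d m)\<^sup>2 \<le> jump_bound\<^sup>2" if "m < M" for m
    using a_nonneg[of m] a_le[OF that] served[of m] params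
    by (intro abs_le_square_iff[THEN iffD1]) (auto simp: jump_bound_def)
  have cross: "(\<Sum>m<M. W z m * a m) = (\<Sum>L\<in>Ls. real (A L) * min_weight z L)"
  proof -
    have "(\<Sum>m<M. W z m * a m) = (\<Sum>m<M. \<Sum>L\<in>Ls. real (r L m) * (W z m / rate L m))"
      by (simp add: a_def sum_distrib_left mult_ac)
    also have "\<dots> = (\<Sum>L\<in>Ls. \<Sum>m<M. real (r L m) * (W z m / rate L m))"
      by (rule sum.swap)
    also have "\<dots> = (\<Sum>L\<in>Ls. \<Sum>m<M. real (r L m) * min_weight z L)"
    proof (intro sum.cong refl)
      fix L m assume "L \<in> Ls"
      then show "real (r L m) * (W z m / rate L m) = real (r L m) * min_weight z L"
        using routing_support(1)[OF r, of L m] by (cases "r L m = 0") auto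
    qed
    also have "\<dots> = (\<Sum>L\<in>Ls. real (A L) * min_weight z L)"
      using routing_support(2)[OF r] by (simp flip: sum_distrib_right of_nat_sum)
    finally show ?thesis .
  qed
  have "lyap (bp_next z r d) = (\<Sum>m<M. (W z m)\<^sup>2 + 2 * (W z m * a m) - 2 * (W z m * served z d m)
      + (a m - served z d m)\<^sup>2)"
    unfolding lyap_def
    by (intro sum.cong refl)
       (simp add: workload_bp_next[OF z] a_def[symmetric] power2_eq_square algebra_simps)
  also have "\<dots> = lyap z + 2 * (\<Sum>m<M. W z m * a m) - 2 * (\<Sum>m<M. W z m * served z d m)
      + (\<Sum>m<M. (a m - served z d m)\<^sup>2)"
    by (simp add: lyap_def sum.distrib sum_subtractf sum_distrib_left)
  also have "(\<Sum>m<M. (a m - served z d m)\<^sup>2) \<le> real M * jump_bound\<^sup>2"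
    using sum_bounded_above[of "{..<M}" _ "jump_bound\<^sup>2"] sq by force
  finally show ?thesis by (simp add: cross)
qed

text \<open>Services are averaged first, which turns the service term into the total workload. What
  remains is free of \<open>r\<close>, so the routing averages a constant, and it is affine in
  \<open>A\<close>, so only the mean arrivals enter.\<close>

lemma lyap_drift:
  assumes z: "z \<in> good_states"
  shows "measure_pmf.expectation (bp_step M K Ls arr \<alpha> \<beta> \<gamma> z) lyap \<le> lyap z + real M * jump_bound\<^sup>2
    + 2 * (\<Sum>L\<in>Ls. measure_pmf.expectation (arr L) real * min_weight z L) - 2 * (\<Sum>m<M. W z m)"
proof -
  have v: "valid_state M z" using z by (simp add: good_states_def)
  define g where "g A = lyap z + real M * jump_bound\<^sup>2
    + 2 * (\<Sum>L\<in>Ls. real (A L) * min_weight z L) - 2 * (\<Sum>m<M. W z m)" for A :: "nat set \<Rightarrow> nat"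
  note int = integrable_measure_pmf_finite[OF finite_services]
  have inner: "measure_pmf.expectation (map_pmf (bp_next z r) (services z)) lyap \<le> g A"
    if A: "A \<in> set_pmf arrivals" and r: "r \<in> set_pmf (routing z A)" for A r
  proof -
    have "measure_pmf.expectation (map_pmf (bp_next z r) (services z)) lyap \<le>
      measure_pmf.expectation (services z) (\<lambda>d. lyap z + real M * jump_bound\<^sup>2
    + 2 * (\<Sum>L\<in>Ls. real (A L) * min_weight z L) - 2 * (\<Sum>m<M. W z m * served z d m))"
      unfolding integral_map_pmf by (intro integral_mono int lyap_bp_next[OF v A r])
    also have "\<dots> = lyap z + real M * jump_bound\<^sup>2 + 2 * (\<Sum>L\<in>Ls. real (A L) * min_weight z L)
        - 2 * (\<Sum>m<M. W z m * measure_pmf.expectation (services z) (\<lambda>d. served z d m))"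
      by (simp add: int)
    also have "\<dots> = g A"
      unfolding g_def by (intro arg_cong2[where f="(-)"] arg_cong2[where f="(*)"] sum.cong refl expectation_served[OF z]) simp
    finally show ?thesis .
  qed
  have "measure_pmf.expectation (bp_step M K Ls arr \<alpha> \<beta> \<gamma> z) lyap \<le> measure_pmf.expectation arrivals g"
    unfolding bp_step_eq
  proof (intro expectation_bind_le finite_arrivals)
    fix A assume A: "A \<in> set_pmf arrivals"
    have "measure_pmf.expectation (routing z A \<bind> (\<lambda>r. map_pmf (bp_next z r) (services z))) lyap
      \<le> measure_pmf.expectation (routing z A) (\<lambda>_. g A)"
      using inner[OF A] finite_services by (intro expectation_bind_le finite_routing) auto
    then show "measure_pmf.expectation (routing z A \<bind> (\<lambda>r. map_pmf (bp_next z r) (services z))) lyap \<le> g A"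
      by simp
  qed (use finite_routing finite_services in auto)
  also have "\<dots> = lyap z + real M * jump_bound\<^sup>2
    + 2 * (\<Sum>L\<in>Ls. measure_pmf.expectation arrivals (\<lambda>A. real (A L)) * min_weight z L) - 2 * (\<Sum>m<M. W z m)"
    unfolding g_def[abs_def] by (simp add: integrable_measure_pmf_finite[OF finite_arrivals])
  finally show ?thesis
    using finite_Ls by (simp add: expectation_Pi_pmf_component)
qed

section \<open>Finite sublevel sets and slack in the capacity constraints\<close>

lemma finite_bounded_workload: "finite {z \<in> good_states. (\<Sum>m<M. W z m) \<le> c}"
proof -
  \<comment> \<open>\<open>PiE_dflt\<close> pins indices outside the system to a default, 0 for
    queues and -1 for the status, as \<open>valid_state\<close> does; this is what makes the
    function spaces finite.\<close>
  let ?Q = "PiE_dflt {..<M} 0 (\<lambda>_. {..nat \<lfloor>c\<rfloor>})"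
  have "{z \<in> good_states. (\<Sum>m<M. W z m) \<le> c} \<subseteq> ?Q \<times> ?Q \<times> ?Q \<times> PiE_dflt {..<M} (-1) (\<lambda>_. {-1, 0, 1, 2})"
  proof
    fix z assume "z \<in> {z \<in> good_states. (\<Sum>m<M. W z m) \<le> c}"
    then have z: "valid_state M z" and c: "(\<Sum>m<M. W z m) \<le> c" by (simp_all add: good_states_def)
    obtain ql qk qr f where zz: "z = (ql, qk, qr, f)" by (cases z)
    have "ql m \<le> nat \<lfloor>c\<rfloor> \<and> qk m \<le> nat \<lfloor>c\<rfloor> \<and> qr m \<le> nat \<lfloor>c\<rfloor>" if m: "m < M" for m
    proof -
      have "W z m \<le> (\<Sum>m<M. W z m)"
        using m W_nonneg by (intro member_le_sum) auto
      then have "W z m \<le> c" using c by simp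
      \<comment> \<open>Rates are at most 1, so each queue length is at most its own share of the
        workload.\<close>
      moreover have "real q \<le> real q / p" if "0 < p" "p \<le> 1" for q p
        using that by (simp add: le_divide_eq mult_left_le)
      then have "real (ql m) \<le> real (ql m) / \<alpha>" "real (qk m) \<le> real (qk m) / \<beta>"
        "real (qr m) \<le> real (qr m) / \<gamma>"
        using params by auto
      moreover have "0 \<le> real (ql m) / \<alpha>" "0 \<le> real (qk m) / \<beta>" "0 \<le> real (qr m) / \<gamma>"
        using params by auto
      ultimately have "real (ql m) \<le> c" "real (qk m) \<le> c" "real (qr m) \<le> c"
        unfolding zz workload_def by auto
      then show ?thesis by (simp add: le_nat_floor)
    qed
    then show "z \<in> ?Q \<times> ?Q \<times> ?Q \<times> PiE_dflt {..<M} (-1) (\<lambda>_. {-1, 0, 1, 2})"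
      using z by (auto simp: zz valid_state_def PiE_dflt_def)
  qed
  then show ?thesis
    by (rule finite_subset) (intro finite_cartesian_product finite_PiE_dflt; simp)
qed

text \<open>A minimum is at most any weighted average, here with weights \<open>lm L m\<close>;
  exchanging the sums collects the load of each server, which is below 1 uniformly as there are
  finitely many servers.\<close>

lemma capacity_slack:
  assumes cap: "lam \<in> capacity_region M K Ls \<alpha> \<beta> \<gamma>"
  shows "\<exists>\<epsilon>>0. \<forall>z. (\<Sum>L\<in>Ls. lam L * min_weight z L) \<le> (1 - \<epsilon>) * (\<Sum>m<M. W z m)"
proof -
  obtain lm where lm: "\<And>L m. L \<in> Ls \<Longrightarrow> m < M \<Longrightarrow> lm L m \<ge> 0"
      "\<And>L. L \<in> Ls \<Longrightarrow> lam L = (\<Sum>m<M. lm L m)"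
      "\<And>m. m < M \<Longrightarrow> (\<Sum>L\<in>Ls. lm L m / rate L m) < 1"
    using cap unfolding capacity_region_def by (auto simp: sum_by_locality)
  define \<rho> where "\<rho> m = (\<Sum>L\<in>Ls. lm L m / rate L m)" for m
  \<comment> \<open>The inserted 1 keeps the minimum defined when there are no servers.\<close>
  define \<epsilon> where "\<epsilon> = Min (insert 1 ((\<lambda>m. 1 - \<rho> m) ` {..<M}))"
  have "\<epsilon> > 0" unfolding \<epsilon>_def using lm(3) by (subst Min_gr_iff) (auto simp: \<rho>_def)
  moreover have \<epsilon>: "\<rho> m \<le> 1 - \<epsilon>" if "m < M" for m
  proof -
    have "\<epsilon> \<le> 1 - \<rho> m" unfolding \<epsilon>_def using that by (intro Min_le) auto
    then show ?thesis by simp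
  qed
  have "(\<Sum>L\<in>Ls. lam L * min_weight z L) \<le> (1 - \<epsilon>) * (\<Sum>m<M. W z m)" for z
  proof -
    have "(\<Sum>L\<in>Ls. lam L * min_weight z L) = (\<Sum>L\<in>Ls. \<Sum>m<M. lm L m * min_weight z L)"
      using lm(2) by (simp add: sum_distrib_right)
    also have "\<dots> \<le> (\<Sum>L\<in>Ls. \<Sum>m<M. lm L m * (W z m / rate L m))"
      using lm(1) min_weight_le by (intro sum_mono mult_left_mono) auto
    also have "\<dots> = (\<Sum>m<M. \<Sum>L\<in>Ls. lm L m * (W z m / rate L m))"
      by (rule sum.swap)
    also have "\<dots> = (\<Sum>m<M. \<rho> m * W z m)"
      by (simp add: \<rho>_def sum_distrib_right)
    also have "\<dots> \<le> (\<Sum>m<M. (1 - \<epsilon>) * W z m)"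
      using \<epsilon> W_nonneg by (intro sum_mono mult_right_mono) auto
    finally show ?thesis by (simp add: sum_distrib_left)
  qed
  ultimately show ?thesis by blast
qed

end

section \<open>Positive recurrence throughout the capacity region\<close>

theorem theorem3p3:
  fixes M :: nat and K :: "nat \<Rightarrow> nat" and Ls :: "nat set set"
    and arr :: "nat set \<Rightarrow> nat pmf" and \<alpha> \<beta> \<gamma> :: real and B :: nat
  assumes types: "\<forall>L\<in>Ls. is_task_type M L"
    and params: "1 \<ge> \<alpha>" "\<alpha> > \<beta>" "\<beta> > \<gamma>" "\<gamma> > 0"
    and bounded: "\<forall>L\<in>Ls. set_pmf (arr L) \<subseteq> {..B}"
    and cap: "(\<lambda>L. measure_pmf.expectation (arr L) real) \<in> capacity_region M K Ls \<alpha> \<beta> \<gamma>"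
    and init: "valid_state M z"
  shows "chain_pos_recurrent_from (bp_step M K Ls arr \<alpha> \<beta> \<gamma>) z"
proof -
  interpret balanced_pandas M K Ls arr \<alpha> \<beta> \<gamma> B
    by unfold_locales (fact types params bounded)+
  obtain \<epsilon> where \<epsilon>: "\<epsilon> > 0"
    and slack: "\<And>z. (\<Sum>L\<in>Ls. measure_pmf.expectation (arr L) real * min_weight z L)
      \<le> (1 - \<epsilon>) * (\<Sum>m<M. W z m)"
    using capacity_slack[OF cap] by blast
  \<comment> \<open>Chosen so that the drift bound \<open>real M * jump_bound\<^sup>2 - 2 *
    \<epsilon> * (\<Sum>m<M. W z m)\<close> equals -1 at total workload \<open>C\<close> and is
    smaller beyond it.\<close>
  define C where "C = (real M * jump_bound\<^sup>2 + 1) / (2 * \<epsilon>)"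
  define F where "F = {z \<in> good_states. (\<Sum>m<M. W z m) \<le> C}"
  interpret foster_drift "bp_step M K Ls arr \<alpha> \<beta> \<gamma>" good_states F lyap
  proof
    fix x assume x: "x \<in> good_states"
    then show "set_pmf (bp_step M K Ls arr \<alpha> \<beta> \<gamma> x) \<subseteq> good_states"
      by (intro bp_step_good) (simp add: good_states_def)
    show "finite (set_pmf (bp_step M K Ls arr \<alpha> \<beta> \<gamma> x))" by (rule finite_bp_step)
    show "0 \<le> lyap x" by (simp add: lyap_def sum_nonneg)
    assume "x \<notin> F"
    then have "real M * jump_bound\<^sup>2 + 1 < 2 * \<epsilon> * (\<Sum>m<M. W x m)"
      using x \<epsilon> by (simp add: F_def C_def divide_less_eq not_le mult_ac)
    then show "measure_pmf.expectation (bp_step M K Ls arr \<alpha> \<beta> \<gamma> x) lyap \<le> lyap x - 1"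
      using lyap_drift[OF x] slack[of x] by (simp add: algebra_simps)
  next
    show "finite F" unfolding F_def by (rule finite_bounded_workload)
  qed
  show ?thesis
  proof (rule chain_pos_recurrent_from_step[OF finite_bp_step])
    fix y assume "y \<in> set_pmf (bp_step M K Ls arr \<alpha> \<beta> \<gamma> z)"
    then show "chain_pos_recurrent_from (bp_step M K Ls arr \<alpha> \<beta> \<gamma>) y"
      using bp_step_good[OF init] by (intro chain_pos_recurrent) blast
  qed
qed

end
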